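(* Let $A=(a,b,c,d,u_0,w_0)$ be real parameters with $ad-bc=1$ and $b\neq 0$. Let $\phi\in L^2(\mathbb{R})\setminus\{0\}$ be a window function and let $f,g\in L^2(\mathbb{R})$. Then for arbitrary constants $\lambda,\mu\in\mathbb{C}$ and all $u,w\in\mathbb{R}$, $$V^{A}_{\phi}(\lambda f+\mu g)(u,w)=\lambda V^{A}_{\phi}f(u,w)+\mu V^{A}_{\phi}g(u,w).$$
   Context: All functions are complex-valued. For $A=(a,b,c,d,u_0,w_0)\in\mathbb{R}^6$ with $ad-bc=1$, $b\neq 0$, the offset linear canonical transform kernel is $$K_A(t,u)=\frac{1}{\sqrt{i2\pi b}}\exp\Big(i\frac{a}{2b}t^2-i\frac1b t(u-u_0)-i\frac1b u(du_0-bw_0)+i\frac{d}{2b}(u^2+u_0^2)\Big)$$ (principal square root). For $\phi\in L^2(\mathbb{R})\setminus\{0\}$ and $f\in L^2(\mathbb{R})$, the windowed offset linear canonical transform (WOLCT) is $$V^A_\phi f(u,w)=\int_{\mathbb{R}} f(t)\,\overline{\phi(t-w)}\,K_A(t,u)\,dt .$$ *)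

theory Defs
  imports "HOL-Analysis.Analysis"
begin

text \<open>Elements of \<open>L\<^sup>2(\<real>)\<close> are represented by functions; two functions that agree almost
  everywhere represent the same element.\<close>

definition L2_fun :: "(real \<Rightarrow> complex) \<Rightarrow> bool" where
  "L2_fun f \<longleftrightarrow> f \<in> borel_measurable lebesgue \<and> integrable lebesgue (\<lambda>t. (norm (f t))\<^sup>2)"

definition L2_nonzero :: "(real \<Rightarrow> complex) \<Rightarrow> bool" where
  "L2_nonzero f \<longleftrightarrow> L2_fun f \<and> \<not> (AE t in lebesgue. f t = 0)"

type_synonym olct_params = "real \<times> real \<times> real \<times> real \<times> real \<times> real"

text \<open>The parameters are \<open>(a, b, c, d, u\<^sub>0, w\<^sub>0)\<close>. The kernel does not mention \<open>c\<close>, which enters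
  only through the condition \<open>a d - b c = 1\<close>.\<close>

definition olct_kernel :: "olct_params \<Rightarrow> real \<Rightarrow> real \<Rightarrow> complex" where
  "olct_kernel = (\<lambda>(a, b, c, d, u0, w0) t u.
     1 / csqrt (\<i> * complex_of_real (2 * pi * b)) *
     exp (\<i> * complex_of_real (a / (2 * b) * t\<^sup>2)
        - \<i> * complex_of_real (1 / b * t * (u - u0))
        - \<i> * complex_of_real (1 / b * u * (d * u0 - b * w0))
        + \<i> * complex_of_real (d / (2 * b) * (u\<^sup>2 + u0\<^sup>2))))"

definition wolct ::
  "olct_params \<Rightarrow> (real \<Rightarrow> complex) \<Rightarrow> (real \<Rightarrow> complex) \<Rightarrow> real \<Rightarrow> real \<Rightarrow> complex" where
  "wolct A \<phi> f u w = (LINT t|lebesgue. f t * cnj (\<phi> (t - w)) * olct_kernel A t u)"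

end

theory Submission
  imports Defs
begin

text \<open>The claim is linearity of the integral, and its content is integrability: the Bochner
  integral is total, and its additivity requires both integrands to be integrable. For fixed
  \<open>w\<close>, \<open>f t * cnj (\<phi> (t - w))\<close> is a product of two square-integrable
  functions, hence integrable (\<open>L2_fun_translation\<close>,
  \<open>L2_fun_integrable_mult_cnj\<close>). The kernel has constant modulus in \<open>t\<close>
  (\<open>norm_olct_kernel\<close>), so multiplying by it preserves integrability
  (\<open>integrable_wolct\<close>).\<close>

lemma lebesgue_measurable_translation:
  fixes w :: real
  shows "(\<lambda>t. t - w) \<in> lebesgue \<rightarrow>\<^sub>M lebesgue"
  using lebesgue_affine_measurable[where c = "\<lambda>_::real. 1" and t = "- w"] by simp

lemma L2_fun_translation:
  assumes "L2_fun \<phi>"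
  shows "L2_fun (\<lambda>t. \<phi> (t - w))"
proof -
  note T = lebesgue_measurable_translation[of w]
  \<comment> \<open>Translation is the affine map of slope 1, so the density factor is 1.\<close>
  have distr: "distr lebesgue lebesgue (\<lambda>t. t - w) = lebesgue"
    using lebesgue_real_affine[of 1 "- w"] by (simp add: density_1)
  have "integrable (distr lebesgue lebesgue (\<lambda>t. t - w)) (\<lambda>t. (norm (\<phi> t))\<^sup>2)"
    using assms by (simp add: distr L2_fun_def)
  from integrable_distr[OF T this] measurable_compose[OF T, of \<phi>] assms
  show ?thesis
    by (simp add: L2_fun_def)
qed

text \<open>Pointwise, the modulus of the product is at most the sum of the two squared moduli,
  which is integrable.\<close>

lemma L2_fun_integrable_mult_cnj:
  assumes "L2_fun f" and "L2_fun g"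
  shows "integrable lebesgue (\<lambda>t. f t * cnj (g t))"
proof (rule Bochner_Integration.integrable_bound)
  show "integrable lebesgue (\<lambda>t. (norm (f t))\<^sup>2 + (norm (g t))\<^sup>2)"
    using assms by (auto simp: L2_fun_def)
  have [measurable]: "f \<in> borel_measurable lebesgue" "g \<in> borel_measurable lebesgue"
    using assms by (auto simp: L2_fun_def)
  have [measurable]: "cnj \<in> borel_measurable borel"
    by (intro borel_measurable_continuous_onI continuous_intros)
  show "(\<lambda>t. f t * cnj (g t)) \<in> borel_measurable lebesgue"
    by measurable
  \<comment> \<open>\<open>2 * x * y\<close> is at most the sum of squares, and \<open>x * y\<close>
    is at most its double because it is nonnegative.\<close>
  have "x * y \<le> x\<^sup>2 + y\<^sup>2" if "0 \<le> x" "0 \<le> y" for x y :: real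
    using sum_squares_bound[of x y] mult_nonneg_nonneg[OF that] by linarith
  then show "AE t in lebesgue. norm (f t * cnj (g t)) \<le> norm ((norm (f t))\<^sup>2 + (norm (g t))\<^sup>2)"
    by (simp add: norm_mult)
qed

text \<open>The exponent is \<open>\<i>\<close> times a real number, so the exponential has modulus
  1 and only the prefactor remains.\<close>

lemma norm_olct_kernel:
  "norm (olct_kernel (a, b, c, d, u0, w0) t u) = norm (1 / csqrt (\<i> * complex_of_real (2 * pi * b)))"
  unfolding olct_kernel_def prod.case norm_mult norm_exp_eq_Re
    plus_complex.sel minus_complex.sel Re_i_times Im_complex_of_real
  by simp

lemma olct_kernel_measurable:
  "(\<lambda>t. olct_kernel (a, b, c, d, u0, w0) t u) \<in> borel_measurable lebesgue"
proof -
  have "continuous_on UNIV (\<lambda>t. olct_kernel (a, b, c, d, u0, w0) t u)"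
    unfolding olct_kernel_def prod.case by (intro continuous_intros)
  then have "(\<lambda>t. olct_kernel (a, b, c, d, u0, w0) t u) \<in> borel_measurable lborel"
    by (simp add: borel_measurable_continuous_onI)
  then show ?thesis
    by (rule measurable_completion)
qed

lemma integrable_wolct:
  assumes "L2_fun \<phi>" and "L2_fun f"
  shows "integrable lebesgue (\<lambda>t. f t * cnj (\<phi> (t - w)) * olct_kernel (a, b, c, d, u0, w0) t u)"
    (is "integrable _ (\<lambda>t. ?h t * ?K t)")
proof (rule Bochner_Integration.integrable_bound)
  let ?C = "1 / csqrt (\<i> * complex_of_real (2 * pi * b))"
  have h: "integrable lebesgue ?h"
    by (intro L2_fun_integrable_mult_cnj L2_fun_translation assms)
  then show "integrable lebesgue (\<lambda>t. ?h t * ?C)"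
    by (rule integrable_mult_left)
  show "(\<lambda>t. ?h t * ?K t) \<in> borel_measurable lebesgue"
    by (intro borel_measurable_times borel_measurable_integrable[OF h] olct_kernel_measurable)
  \<comment> \<open>Equality holds at every \<open>t\<close>, since \<open>?K t\<close> and
    \<open>?C\<close> have the same modulus.\<close>
  show "AE t in lebesgue. norm (?h t * ?K t) \<le> norm (?h t * ?C)"
    by (simp only: norm_mult norm_olct_kernel order_refl eventually_True)
qed

theorem mainTheorem1:
  fixes a b c d u0 w0 :: real
    and \<phi> f g :: "real \<Rightarrow> complex"
    and lam mu :: complex
    and u w :: real
  assumes "a * d - b * c = 1" and "b \<noteq> 0"
    and "L2_nonzero \<phi>"
    and "L2_fun f" and "L2_fun g"
  shows "wolct (a, b, c, d, u0, w0) \<phi> (\<lambda>t. lam * f t + mu * g t) u w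
       = lam * wolct (a, b, c, d, u0, w0) \<phi> f u w + mu * wolct (a, b, c, d, u0, w0) \<phi> g u w"
proof -
  from assms have "L2_fun \<phi>"
    by (simp add: L2_nonzero_def)
  note int = integrable_wolct[OF this \<open>L2_fun f\<close>] integrable_wolct[OF this \<open>L2_fun g\<close>]
  show ?thesis
    \<comment> \<open>The integrability facts are reassociated like the integrands, so that they
      discharge the side conditions of additivity.\<close>
    by (simp add: wolct_def distrib_right mult.assoc int[unfolded mult.assoc])
qed

end
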